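(* Let $\mathbf X=(X_1,\dots,X_n)$ be a joint mix and, for $A\subseteq[n]$, write $S_A=\sum_{i\in A}X_i$ and $\mathbf X_A=(X_i)_{i\in A}$. Suppose that (a) for every $A\subseteq[n]$, the random vectors $\mathbf X_A$ and $\mathbf X_{[n]\setminus A}$ are independent conditionally on $S_A$; (b) for every $A\subseteq[n]$ and every coordinate-wise increasing function $f:\mathbb R^{|A|}\to\mathbb R$, the conditional expectation $\mathbb E[f(\mathbf X_A)\mid S_A]$ is increasing in $S_A$. Then $\mathbf X$ is negatively associated.
   Context: $[n]=\{1,\dots,n\}$. "Increasing" means non-decreasing. A random vector $\mathbf X=(X_1,\dots,X_n)$ is a joint mix if $\sum_{i=1}^n X_i=c$ almost surely for some constant $c\in\mathbb R$. It is negatively associated (NA) if $\mathrm{Cov}(f(\mathbf X_A),g(\mathbf X_B))\le 0$ for any disjoint (nonempty) $A,B\subseteq[n]$ and any real-valued coordinate-wise increasing functions $f,g$ such that $f(\mathbf X_A)$ and $g(\mathbf X_B)$ have finite second moments. In (b), $f$ ranges over functions for which $f(\mathbf X_A)$ is integrable, and "increasing in $S_A$" means that the conditional expectation equals $h(S_A)$ almost surely for some increasing function $h$. *)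

theory Defs
  imports "HOL-Probability.Probability"
begin

definition partial_sum :: "(nat \<Rightarrow> 'a \<Rightarrow> real) \<Rightarrow> nat set \<Rightarrow> 'a \<Rightarrow> real" where
  "partial_sum X A \<omega> = (\<Sum>i\<in>A. X i \<omega>)"

definition subvector :: "(nat \<Rightarrow> 'a \<Rightarrow> real) \<Rightarrow> nat set \<Rightarrow> 'a \<Rightarrow> nat \<Rightarrow> real" where
  "subvector X A \<omega> = (\<lambda>i\<in>A. X i \<omega>)"

text \<open>The space of real vectors indexed by \<open>A\<close> is \<open>A \<rightarrow>\<^sub>E UNIV\<close>, with the product Borel
  sigma-algebra.\<close>

abbreviation borel_vec :: "nat set \<Rightarrow> (nat \<Rightarrow> real) measure" where
  "borel_vec A \<equiv> Pi\<^sub>M A (\<lambda>_. borel)"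

text \<open>All elements of \<open>A \<rightarrow>\<^sub>E UNIV\<close> agree outside \<open>A\<close>, so the pointwise order on them is the
  coordinate-wise order on \<open>A\<close>. Borel measurability is part of the notion: for two or more
  coordinates it does not follow from monotonicity.\<close>

definition coord_increasing :: "nat set \<Rightarrow> ((nat \<Rightarrow> real) \<Rightarrow> real) \<Rightarrow> bool" where
  "coord_increasing A f \<longleftrightarrow>
     f \<in> borel_measurable (borel_vec A) \<and> mono_on (A \<rightarrow>\<^sub>E UNIV) f"

definition joint_mix :: "'a measure \<Rightarrow> nat \<Rightarrow> (nat \<Rightarrow> 'a \<Rightarrow> real) \<Rightarrow> bool" where
  "joint_mix M n X \<longleftrightarrow> (\<exists>c. AE \<omega> in M. (\<Sum>i\<in>{1..n}. X i \<omega>) = c)"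

definition covariance :: "'a measure \<Rightarrow> ('a \<Rightarrow> real) \<Rightarrow> ('a \<Rightarrow> real) \<Rightarrow> real" where
  "covariance M U V =
     (\<integral>\<omega>. (U \<omega> - (\<integral>x. U x \<partial>M)) * (V \<omega> - (\<integral>x. V x \<partial>M)) \<partial>M)"

definition negatively_associated :: "'a measure \<Rightarrow> nat \<Rightarrow> (nat \<Rightarrow> 'a \<Rightarrow> real) \<Rightarrow> bool" where
  "negatively_associated M n X \<longleftrightarrow>
     (\<forall>A B f g. A \<noteq> {} \<longrightarrow> B \<noteq> {} \<longrightarrow> A \<subseteq> {1..n} \<longrightarrow> B \<subseteq> {1..n} \<longrightarrow> A \<inter> B = {} \<longrightarrow>
        coord_increasing A f \<longrightarrow> coord_increasing B g \<longrightarrow>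
        integrable M (\<lambda>\<omega>. (f (subvector X A \<omega>))\<^sup>2) \<longrightarrow>
        integrable M (\<lambda>\<omega>. (g (subvector X B \<omega>))\<^sup>2) \<longrightarrow>
        covariance M (\<lambda>\<omega>. f (subvector X A \<omega>)) (\<lambda>\<omega>. g (subvector X B \<omega>)) \<le> 0)"

text \<open>Conditional expectation given a real random variable \<open>S\<close>, that is, given the
  sigma-algebra on \<open>space M\<close> generated by \<open>S\<close>.\<close>

definition cond_exp_given :: "'a measure \<Rightarrow> ('a \<Rightarrow> real) \<Rightarrow> ('a \<Rightarrow> real) \<Rightarrow> 'a \<Rightarrow> real" where
  "cond_exp_given M S Y = real_cond_exp M (vimage_algebra (space M) S borel) Y"

definition cond_indep_given ::
  "'a measure \<Rightarrow> ('a \<Rightarrow> real) \<Rightarrow> 'b measure \<Rightarrow> ('a \<Rightarrow> 'b) \<Rightarrow> 'c measure \<Rightarrow> ('a \<Rightarrow> 'c) \<Rightarrow> bool" where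
  "cond_indep_given M S N Y N' Z \<longleftrightarrow>
     (\<forall>E\<in>sets N. \<forall>F\<in>sets N'. AE \<omega> in M.
        cond_exp_given M S (\<lambda>x. indicator E (Y x) * indicator F (Z x)) \<omega> =
        cond_exp_given M S (\<lambda>x. indicator E (Y x)) \<omega> *
        cond_exp_given M S (\<lambda>x. indicator F (Z x)) \<omega>)"

definition cond_exp_increasing :: "'a measure \<Rightarrow> ('a \<Rightarrow> real) \<Rightarrow> ('a \<Rightarrow> real) \<Rightarrow> bool" where
  "cond_exp_increasing M S Y \<longleftrightarrow>
     (\<exists>h :: real \<Rightarrow> real. mono h \<and> (AE \<omega> in M. cond_exp_given M S Y \<omega> = h (S \<omega>)))"

end

theory Submission
  imports Defs
begin

text \<open>Let \<open>C\<close> be the complement of \<open>A\<close> and read \<open>g\<close> as a function of \<open>X\<^sub>C\<close> that ignores the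
  coordinates outside \<open>B\<close>. By conditional independence,
  \<open>E[f(X\<^sub>A) g(X\<^sub>C)] = E[E[f(X\<^sub>A) | S\<^sub>A] E[g(X\<^sub>C) | S\<^sub>A]]\<close>. The first factor is increasing in
  \<open>S\<^sub>A\<close>. The second is an increasing function of \<open>S\<^sub>C = c - S\<^sub>A\<close>, hence decreasing in \<open>S\<^sub>A\<close>, and
  Chebyshev's association inequality bounds the expectation of the product by the product of the
  expectations.\<close>

section \<open>Sigma-algebras generated by a random variable\<close>

lemma subalgebra_vimage_algebra:
  assumes "f \<in> measurable M N"
  shows "subalgebra M (vimage_algebra (space M) f N)"
  using assms by (auto simp: subalgebra_def sets_vimage_algebra2 measurable_def)

text \<open>Finite measures restrict to finite ones. This makes the locale with the rules for
  \<open>real_cond_exp\<close> available for conditioning on any random variable.\<close>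

lemma (in prob_space) sigma_finite_subalgebra_vimage_algebra:
  assumes "f \<in> measurable M N"
  shows "sigma_finite_subalgebra M (vimage_algebra (space M) f N)"
  using finite_measure_subalgebra_is_sigma_finite[OF finite_measure_subalgebra.intro]
    finite_measure_axioms subalgebra_vimage_algebra[OF assms]
  by (metis finite_measure_subalgebra_axioms.intro finite_measure_subalgebra_def)

text \<open>Chebyshev's association inequality, obtained by integrating
  \<open>(U x - U y) * (V x - V y) \<le> 0\<close> in \<open>y\<close> and then in \<open>x\<close>.\<close>

lemma (in prob_space) expectation_mult_le_opposite_monotone:
  fixes h k :: "real \<Rightarrow> real"
  assumes h: "mono h" and k: "antimono k"
    and U: "AE x in M. U x = h (S x)" and V: "AE x in M. V x = k (S x)"
    and iU: "integrable M U" and iV: "integrable M V"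
    and iUV: "integrable M (\<lambda>x. U x * V x)"
  shows "expectation (\<lambda>x. U x * V x) \<le> expectation U * expectation V"
proof -
  let ?e = "expectation (\<lambda>x. U x * V x)"
  have pointwise: "(h s - h t) * (k s - k t) \<le> 0" for s t
    using h k by (cases "s \<le> t") (auto simp: mult_le_0_iff monotone_def)
  have "AE x in M. U x * V x - U x * expectation V - V x * expectation U + ?e \<le> 0"
    using U V
  proof eventually_elim
    case (elim x)
    have "AE y in M. U x * V x - U x * V y - V x * U y + U y * V y \<le> 0"
      using U V
    proof eventually_elim
      case (elim y)
      then show ?case
        using \<open>U x = h (S x)\<close> \<open>V x = k (S x)\<close> pointwise[of "S x" "S y"]
        by (simp add: algebra_simps)
    qed
    then have "expectation (\<lambda>y. U x * V x - U x * V y - V x * U y + U y * V y)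
        \<le> expectation (\<lambda>y. 0)"
      using iU iV iUV by (intro integral_mono_AE) auto
    then show ?case
      using iU iV iUV by (simp add: prob_space)
  qed
  then have "expectation (\<lambda>x. U x * V x - U x * expectation V - V x * expectation U + ?e)
      \<le> expectation (\<lambda>x. 0)"
    using iU iV iUV by (intro integral_mono_AE) auto
  \<comment> \<open>The product and the constant \<open>?e\<close> contribute \<open>?e\<close>
    each, the two mixed terms each contribute minus the product of the expectations, so this is
    twice the claim.\<close>
  then show ?thesis
    using iU iV iUV by (simp add: prob_space algebra_simps)
qed

section \<open>Conditional independence and expectations of products\<close>

text \<open>If \<open>S\<close> is a function of \<open>Y\<close>, conditional independence says that conditioning a function
  of \<open>Z\<close> on \<open>Y\<close> is the same as conditioning it on \<open>S\<close>.\<close>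

lemma (in prob_space) cond_indep_given_cond_exp_eq:
  fixes u :: "'c \<Rightarrow> real"
  assumes Y: "Y \<in> measurable M N" and Z: "Z \<in> measurable M N'"
    and \<phi>: "\<phi> \<in> borel_measurable N" and S: "S = (\<lambda>x. \<phi> (Y x))"
    and indep: "cond_indep_given M S N Y N' Z"
    and u: "u \<in> borel_measurable N'" and iu: "integrable M (\<lambda>x. u (Z x))"
  shows "AE x in M. real_cond_exp M (vimage_algebra (space M) Y N) (\<lambda>x. u (Z x)) x
           = cond_exp_given M S (\<lambda>x. u (Z x)) x"
proof -
  let ?G = "vimage_algebra (space M) Y N" and ?F = "vimage_algebra (space M) S borel"
  have S_meas: "S \<in> borel_measurable M"
    using Y \<phi> unfolding S by measurable
  interpret G: sigma_finite_subalgebra M ?G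
    by (rule sigma_finite_subalgebra_vimage_algebra[OF Y])
  interpret F: sigma_finite_subalgebra M ?F
    by (rule sigma_finite_subalgebra_vimage_algebra[OF S_meas])
  have Y': "Y \<in> measurable ?G N"
    using measurable_space[OF Y] by (intro measurable_vimage_algebra1) auto
  have S_G: "S \<in> borel_measurable ?G"
    using measurable_compose[OF Y' \<phi>] by (simp add: S)
  \<comment> \<open>Since \<open>S\<close> factors through \<open>Y\<close>, \<open>?F\<close> is
    contained in \<open>?G\<close>, so the right-hand side is an admissible candidate for
    conditioning on \<open>Y\<close>. It remains to compare integrals over the sets of
    \<open>?G\<close>.\<close>
  have "subalgebra ?G ?F"
    using subalgebra_vimage_algebra[OF S_G] by simp
  then have ce_G: "cond_exp_given M S w \<in> borel_measurable ?G" for w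
    unfolding cond_exp_given_def by (intro measurable_from_subalg[OF _ borel_measurable_cond_exp])
  show ?thesis
  proof (rule G.real_cond_exp_charact)
    show "integrable M (\<lambda>x. u (Z x))" by (rule iu)
    show "integrable M (cond_exp_given M S (\<lambda>x. u (Z x)))"
      unfolding cond_exp_given_def by (rule F.real_cond_exp_int(1)[OF iu])
    show "cond_exp_given M S (\<lambda>x. u (Z x)) \<in> borel_measurable ?G" by (rule ce_G)
  next
    fix T assume "T \<in> sets ?G"
    then obtain E where E: "E \<in> sets N" and T: "T = Y -` E \<inter> space M"
      using measurable_space[OF Y] by (auto simp: sets_vimage_algebra2)
    \<comment> \<open>On \<open>space M\<close>, \<open>a\<close> is the indicator of
      \<open>T\<close>; \<open>p\<close> is the conditional probability of \<open>T\<close> given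
      \<open>S\<close>. The integral over \<open>T\<close> is computed by exchanging
      \<open>a\<close> for \<open>p\<close>, conditioning \<open>u (Z x)\<close> on
      \<open>S\<close>, and exchanging \<open>p\<close> back for \<open>a\<close>.\<close>
    define a where "a = (\<lambda>x. indicator E (Y x) :: real)"
    define p where "p = real_cond_exp M ?F a"
    have [measurable]: "a \<in> borel_measurable M"
      unfolding a_def by (rule measurable_compose[OF Y borel_measurable_indicator[OF E]])
    have a_bounds: "0 \<le> a x" "a x \<le> 1" for x
      by (auto simp: a_def)
    have ia: "integrable M a"
      by (rule integrable_const_bound[where B=1]) (auto simp: a_bounds)
    have [measurable]: "p \<in> borel_measurable M" "p \<in> borel_measurable ?F"
      unfolding p_def by auto
    have p_bounds: "AE x in M. 0 \<le> p x \<and> p x \<le> 1"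
    proof -
      have "AE x in M. p x \<ge> 0"
        unfolding p_def by (rule F.real_cond_exp_pos) (auto simp: a_bounds)
      moreover have "AE x in M. p x \<le> 1"
        unfolding p_def by (rule F.real_cond_exp_le_c[OF ia]) (auto simp: a_bounds)
      ultimately show ?thesis by eventually_elim auto
    qed
    \<comment> \<open>a version of \<open>p\<close> that is nonnegative everywhere, so that it is a density\<close>
    define q where "q = (\<lambda>x. max 0 (p x))"
    have q_eq: "AE x in M. q x = p x"
      using p_bounds by eventually_elim (auto simp: q_def)
    have [measurable]: "q \<in> borel_measurable M" unfolding q_def by measurable
    have mult_int: "integrable M (\<lambda>x. p x * w x)" if "integrable M w" for w
    proof (rule Bochner_Integration.integrable_bound[OF that])
      show "AE x in M. norm (p x * w x) \<le> norm (w x)"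
        using p_bounds by eventually_elim (auto simp: abs_mult intro!: mult_left_le_one_le)
    qed (use that in measurable)
    have a_int: "integrable M (\<lambda>x. a x * w x)" if "integrable M w" for w
      using that by (intro Bochner_Integration.integrable_bound[OF that])
        (auto simp: a_bounds abs_mult intro!: mult_left_le_one_le)
    \<comment> \<open>On indicators, conditional independence says that \<open>a\<close> and \<open>p\<close> integrate alike against
      functions of \<open>Z\<close>. An equality of measures carries this over to all integrable \<open>u (Z x)\<close>.\<close>
    have "distr (density M a) N' Z = distr (density M q) N' Z"
    proof (rule measure_eqI)
      fix D assume "D \<in> sets (distr (density M a) N' Z)"
      then have D[measurable]: "D \<in> sets N'" by simp
      define b where "b = (\<lambda>x. indicator D (Z x) :: real)"
      have [measurable]: "b \<in> borel_measurable M"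
        unfolding b_def by (rule measurable_compose[OF Z borel_measurable_indicator[OF D]])
      have b_bounds: "0 \<le> b x" "b x \<le> 1" for x
        by (auto simp: b_def)
      have ib: "integrable M b"
        by (rule integrable_const_bound[where B=1]) (auto simp: b_bounds)
      have iqb: "integrable M (\<lambda>x. q x * b x)"
        by (rule Bochner_Integration.integrable_cong_AE_imp[OF mult_int[OF ib]])
          (use q_eq in \<open>auto elim!: eventually_mono\<close>)
      \<comment> \<open>Tower property, then conditional independence of the two events; finally
        \<open>p\<close>, being measurable for \<open>?F\<close>, allows the conditioning on
        \<open>b\<close> to be removed.\<close>
      have "expectation (\<lambda>x. a x * b x) = expectation (real_cond_exp M ?F (\<lambda>x. a x * b x))"
        by (rule F.real_cond_exp_int(2)[symmetric, OF a_int[OF ib]])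
      also have "\<dots> = expectation (\<lambda>x. p x * real_cond_exp M ?F b x)"
        using indep E D
        by (intro integral_cong_AE)
          (auto simp: cond_indep_given_def cond_exp_given_def p_def a_def b_def)
      also have "\<dots> = expectation (\<lambda>x. p x * b x)"
        by (rule F.real_cond_exp_intg(2)) (auto intro: mult_int ib)
      also have "\<dots> = expectation (\<lambda>x. q x * b x)"
        using q_eq by (intro integral_cong_AE) auto
      finally have eq: "expectation (\<lambda>x. a x * b x) = expectation (\<lambda>x. q x * b x)" .
      have "emeasure (distr (density M w) N' Z) D = ennreal (expectation (\<lambda>x. w x * b x))"
        if "w \<in> borel_measurable M" "\<And>x. w x \<ge> 0" "integrable M (\<lambda>x. w x * b x)" for w
      proof -
        have "emeasure (distr (density M w) N' Z) D = emeasure (density M w) (Z -` D \<inter> space M)"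
          using Z D by (simp add: emeasure_distr)
        also have "\<dots> = (\<integral>\<^sup>+x. ennreal (w x) * indicator (Z -` D \<inter> space M) x \<partial>M)"
          using that(1) measurable_sets[OF Z D] by (simp add: emeasure_density)
        also have "\<dots> = (\<integral>\<^sup>+x. ennreal (w x * b x) \<partial>M)"
          by (intro nn_integral_cong) (auto simp: b_def indicator_def)
        also have "\<dots> = ennreal (expectation (\<lambda>x. w x * b x))"
          using that by (intro nn_integral_eq_integral) (auto simp: b_bounds)
        finally show ?thesis .
      qed
      from this[of a] this[of q] eq
      show "emeasure (distr (density M a) N' Z) D = emeasure (distr (density M q) N' Z) D"
        using a_int[OF ib] iqb by (simp add: a_bounds q_def)
    qed simp
    moreover have "integral\<^sup>L (distr (density M w) N' Z) u = expectation (\<lambda>x. w x * u (Z x))"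
      if "w \<in> borel_measurable M" "\<And>x. w x \<ge> 0" for w
    proof -
      have "integral\<^sup>L (distr (density M w) N' Z) u = (\<integral>x. u (Z x) \<partial>density M w)"
        using Z u by (intro integral_distr) auto
      also have "\<dots> = expectation (\<lambda>x. w x * u (Z x))"
        using that iu by (subst integral_density) auto
      finally show ?thesis .
    qed
    ultimately have eq: "expectation (\<lambda>x. a x * u (Z x)) = expectation (\<lambda>x. q x * u (Z x))"
      by (metis \<open>a \<in> borel_measurable M\<close> \<open>q \<in> borel_measurable M\<close> a_bounds(1) max.cobounded1 q_def)
    have "set_lebesgue_integral M T (\<lambda>x. u (Z x)) = expectation (\<lambda>x. a x * u (Z x))"
      unfolding set_lebesgue_integral_def T a_def
      by (intro Bochner_Integration.integral_cong) (auto simp: indicator_def)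
    also have "\<dots> = expectation (\<lambda>x. p x * u (Z x))"
      unfolding eq using q_eq iu by (intro integral_cong_AE) auto
    also have "\<dots> = expectation (\<lambda>x. p x * cond_exp_given M S (\<lambda>x. u (Z x)) x)"
      unfolding cond_exp_given_def
      by (rule F.real_cond_exp_intg(2)[symmetric]) (use iu in \<open>auto intro: mult_int\<close>)
    also have "\<dots> = expectation (\<lambda>x. cond_exp_given M S (\<lambda>x. u (Z x)) x * p x)"
      by (simp add: mult.commute)
    \<comment> \<open>The exchange back rests on a different reason: the other factor is now
      measurable for \<open>?F\<close>, so \<open>p\<close> may be replaced by the variable it
      conditions.\<close>
    also have "\<dots> = expectation (\<lambda>x. cond_exp_given M S (\<lambda>x. u (Z x)) x * a x)"
      unfolding p_def cond_exp_given_def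
      using a_int[OF F.real_cond_exp_int(1)[OF iu]]
      by (intro F.real_cond_exp_intg(2)) (auto simp: mult.commute)
    also have "\<dots> = set_lebesgue_integral M T (cond_exp_given M S (\<lambda>x. u (Z x)))"
      unfolding set_lebesgue_integral_def T a_def
      by (intro Bochner_Integration.integral_cong) (auto simp: indicator_def)
    finally show "set_lebesgue_integral M T (\<lambda>x. u (Z x))
        = set_lebesgue_integral M T (cond_exp_given M S (\<lambda>x. u (Z x)))" .
  qed
qed

text \<open>Conditioning on \<open>Y\<close> first leaves \<open>v (Y x)\<close> untouched and turns
  \<open>u (Z x)\<close> into its conditional expectation given \<open>S\<close>. That factor is a
  function of \<open>S\<close>, so conditioning on \<open>S\<close> next acts on
  \<open>v (Y x)\<close> alone.\<close>

lemma (in prob_space) cond_indep_given_expectation_mult: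
  fixes v :: "'b \<Rightarrow> real" and u :: "'c \<Rightarrow> real"
  assumes Y: "Y \<in> measurable M N" and Z: "Z \<in> measurable M N'"
    and \<phi>: "\<phi> \<in> borel_measurable N" and S: "S = (\<lambda>x. \<phi> (Y x))"
    and indep: "cond_indep_given M S N Y N' Z"
    and v: "v \<in> borel_measurable N" and iv: "integrable M (\<lambda>x. v (Y x))"
    and u: "u \<in> borel_measurable N'" and iu: "integrable M (\<lambda>x. u (Z x))"
    and ivu: "integrable M (\<lambda>x. v (Y x) * u (Z x))"
  shows "integrable M (\<lambda>x. cond_exp_given M S (\<lambda>x. v (Y x)) x * cond_exp_given M S (\<lambda>x. u (Z x)) x)"
    and "expectation (\<lambda>x. v (Y x) * u (Z x)) =
      expectation (\<lambda>x. cond_exp_given M S (\<lambda>x. v (Y x)) x * cond_exp_given M S (\<lambda>x. u (Z x)) x)"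
proof -
  let ?G = "vimage_algebra (space M) Y N" and ?F = "vimage_algebra (space M) S borel"
  let ?v = "cond_exp_given M S (\<lambda>x. v (Y x))" and ?u = "cond_exp_given M S (\<lambda>x. u (Z x))"
  have S_meas: "S \<in> borel_measurable M"
    using Y \<phi> unfolding S by measurable
  interpret G: sigma_finite_subalgebra M ?G
    by (rule sigma_finite_subalgebra_vimage_algebra[OF Y])
  interpret F: sigma_finite_subalgebra M ?F
    by (rule sigma_finite_subalgebra_vimage_algebra[OF S_meas])
  have Y': "Y \<in> measurable ?G N"
    using measurable_space[OF Y] by (intro measurable_vimage_algebra1) auto
  have vG: "(\<lambda>x. v (Y x)) \<in> borel_measurable ?G"
    using measurable_compose[OF Y' v] .
  have u_meas: "(\<lambda>x. u (Z x)) \<in> borel_measurable M" and v_meas: "(\<lambda>x. v (Y x)) \<in> borel_measurable M"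
    using iu iv by auto
  have [measurable]: "?u \<in> borel_measurable M" "?u \<in> borel_measurable ?F" "?v \<in> borel_measurable M"
    unfolding cond_exp_given_def by auto
  have ce: "AE x in M. real_cond_exp M ?G (\<lambda>x. u (Z x)) x = ?u x"
    by (rule cond_indep_given_cond_exp_eq[OF Y Z \<phi> S indep u iu])
  note G = G.real_cond_exp_intg[OF ivu vG u_meas]
  have int: "integrable M (\<lambda>x. ?u x * v (Y x))"
    by (rule Bochner_Integration.integrable_cong_AE_imp[OF G(1)])
      (use ce v_meas in \<open>auto elim!: eventually_mono\<close>)
  note F = F.real_cond_exp_intg[OF int _ v_meas]
  show "integrable M (\<lambda>x. ?v x * ?u x)"
    using F(1) by (simp add: cond_exp_given_def mult.commute)
  have "expectation (\<lambda>x. v (Y x) * u (Z x)) = expectation (\<lambda>x. ?u x * v (Y x))"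
    unfolding G(2)[symmetric]
    by (intro integral_cong_AE) (use ce v_meas in \<open>auto elim!: eventually_mono\<close>)
  also have "\<dots> = expectation (\<lambda>x. ?v x * ?u x)"
    using F(2) by (simp add: cond_exp_given_def mult.commute)
  finally show "expectation (\<lambda>x. v (Y x) * u (Z x)) = expectation (\<lambda>x. ?v x * ?u x)" .
qed

section \<open>Reflection of the conditioning variable\<close>

text \<open>The sigma-algebras generated by \<open>S\<close> and by \<open>c - S\<close> agree, but \<open>S' = c - S\<close> holds only
  almost surely, so the two conditional expectations are compared through their integrals.\<close>

lemma (in prob_space) cond_exp_given_reflect:
  fixes h :: "real \<Rightarrow> real"
  assumes S: "S \<in> borel_measurable M" and S': "S' \<in> borel_measurable M"
    and refl: "AE x in M. S' x = c - S x"
    and W: "integrable M W" and h: "h \<in> borel_measurable borel"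
    and ce: "AE x in M. cond_exp_given M S' W x = h (S' x)"
  shows "AE x in M. cond_exp_given M S W x = h (c - S x)"
proof -
  let ?F = "vimage_algebra (space M) S borel" and ?F' = "vimage_algebra (space M) S' borel"
  interpret F: sigma_finite_subalgebra M ?F
    by (rule sigma_finite_subalgebra_vimage_algebra[OF S])
  interpret F': sigma_finite_subalgebra M ?F'
    by (rule sigma_finite_subalgebra_vimage_algebra[OF S'])
  note [measurable] = S S' h
  have [measurable]: "S \<in> borel_measurable ?F" "S' \<in> borel_measurable ?F'"
    by (intro measurable_vimage_algebra1; simp)+
  have [measurable]: "W \<in> borel_measurable M" using W by auto
  show ?thesis
    unfolding cond_exp_given_def
  proof (rule F.real_cond_exp_charact)
    show "integrable M W" by (rule W)
    show "integrable M (\<lambda>x. h (c - S x))"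
      by (rule Bochner_Integration.integrable_cong_AE_imp[OF F'.real_cond_exp_int(1)[OF W]])
        (use ce refl in \<open>auto simp: cond_exp_given_def elim!: eventually_elim2\<close>)
    show "(\<lambda>x. h (c - S x)) \<in> borel_measurable ?F" by measurable
  next
    fix T assume "T \<in> sets ?F"
    then obtain D where D[measurable]: "D \<in> sets borel" and T: "T = S -` D \<inter> space M"
      by (auto simp: sets_vimage_algebra2)
    \<comment> \<open>\<open>T'\<close> is the event \<open>T\<close> rewritten through
      \<open>S'\<close>: it lies in \<open>?F'\<close> and differs from \<open>T\<close> by a null
      set. Integrals over \<open>T\<close> can thus be evaluated by conditioning on
      \<open>S'\<close>.\<close>
    define T' where "T' = {x\<in>space M. c - S' x \<in> D}"
    have "T' = {x\<in>space ?F'. c - S' x \<in> D}" by (simp add: T'_def)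
    also have "\<dots> \<in> sets ?F'" by measurable
    finally have T'_in: "T' \<in> sets ?F'" .
    have TT': "AE x in M. x \<in> T \<longleftrightarrow> x \<in> T'"
      using refl by eventually_elim (auto simp: T T'_def)
    have [measurable]: "T \<in> sets M" "T' \<in> sets M"
      unfolding T T'_def by measurable
    have "set_lebesgue_integral M T W = set_lebesgue_integral M T' W"
      unfolding set_lebesgue_integral_def
      by (intro integral_cong_AE) (use TT' in \<open>auto simp: indicator_def elim!: eventually_mono\<close>)
    also have "\<dots> = set_lebesgue_integral M T' (real_cond_exp M ?F' W)"
      by (rule F'.real_cond_exp_intA[OF W T'_in])
    also have "\<dots> = set_lebesgue_integral M T (\<lambda>x. h (c - S x))"
      unfolding set_lebesgue_integral_def
    proof (intro integral_cong_AE)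
      show "AE x in M. indicator T' x *\<^sub>R real_cond_exp M ?F' W x = indicator T x *\<^sub>R h (c - S x)"
        using TT' refl ce by eventually_elim (auto simp: indicator_def cond_exp_given_def)
    qed auto
    finally show "set_lebesgue_integral M T W = set_lebesgue_integral M T (\<lambda>x. h (c - S x))" .
  qed
qed

section \<open>Subvectors and passage to larger index sets\<close>

lemma subvector_measurable:
  assumes "\<And>i. i \<in> A \<Longrightarrow> X i \<in> borel_measurable M"
  shows "subvector X A \<in> measurable M (borel_vec A)"
  unfolding subvector_def using assms by (intro measurable_restrict) auto

text \<open>Restriction to \<open>B\<close> is measurable and preserves the coordinate-wise order.
  The hypotheses pair \<open>A\<close> with its whole complement, while negative association allows
  a smaller \<open>B\<close>.\<close>

lemma coord_increasing_restrict:
  assumes "coord_increasing B g" and "B \<subseteq> C"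
  shows "coord_increasing C (\<lambda>x. g (restrict x B))"
proof -
  have "(\<lambda>x. restrict x B) \<in> measurable (borel_vec C) (borel_vec B)"
    by (rule measurable_restrict_subset[OF assms(2)])
  then show ?thesis
    using assms by (auto simp: coord_increasing_def monotone_on_def le_fun_def intro: measurable_compose)
qed

lemma restrict_subvector:
  assumes "B \<subseteq> C"
  shows "restrict (subvector X C \<omega>) B = subvector X B \<omega>"
  using assms by (auto simp: subvector_def restrict_def fun_eq_iff)

theorem theorem1:
  fixes M :: "'a measure" and n :: nat and X :: "nat \<Rightarrow> 'a \<Rightarrow> real"
  assumes "prob_space M"
    and "\<And>i. i \<in> {1..n} \<Longrightarrow> X i \<in> borel_measurable M"
    and "joint_mix M n X"
    and "\<And>A. A \<subseteq> {1..n} \<Longrightarrow>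
           cond_indep_given M (partial_sum X A)
             (borel_vec A) (subvector X A)
             (borel_vec ({1..n} - A)) (subvector X ({1..n} - A))"
    and "\<And>A f. A \<subseteq> {1..n} \<Longrightarrow> coord_increasing A f \<Longrightarrow>
           integrable M (\<lambda>\<omega>. f (subvector X A \<omega>)) \<Longrightarrow>
           cond_exp_increasing M (partial_sum X A) (\<lambda>\<omega>. f (subvector X A \<omega>))"
  shows "negatively_associated M n X"
  unfolding negatively_associated_def
proof (intro allI impI)
  interpret prob_space M by fact
  fix A B f g
  assume A: "A \<subseteq> {1..n}" and B: "B \<subseteq> {1..n}" and disj: "A \<inter> B = {}"
    and f: "coord_increasing A f" and g: "coord_increasing B g"
    and f2: "integrable M (\<lambda>\<omega>. (f (subvector X A \<omega>))\<^sup>2)"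
    and g2: "integrable M (\<lambda>\<omega>. (g (subvector X B \<omega>))\<^sup>2)"
  define C where "C = {1..n} - A"
  define u where "u = (\<lambda>x. g (restrict x B))"
  let ?S = "partial_sum X A" and ?S' = "partial_sum X C"
  let ?V = "\<lambda>\<omega>. f (subvector X A \<omega>)" and ?U = "\<lambda>\<omega>. u (subvector X C \<omega>)"
  have C: "C \<subseteq> {1..n}" and BC: "B \<subseteq> C"
    using B disj by (auto simp: C_def)
  have u: "coord_increasing C u"
    unfolding u_def by (rule coord_increasing_restrict[OF g BC])
  have U_eq: "?U = (\<lambda>\<omega>. g (subvector X B \<omega>))"
    by (simp add: u_def restrict_subvector[OF BC])
  have Y: "subvector X A \<in> measurable M (borel_vec A)"
    and Z: "subvector X C \<in> measurable M (borel_vec C)"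
    using assms(2) A C by (auto intro!: subvector_measurable)
  have fm: "f \<in> borel_measurable (borel_vec A)" and um: "u \<in> borel_measurable (borel_vec C)"
    using f u by (auto simp: coord_increasing_def)
  have Vm: "?V \<in> borel_measurable M" and Um: "?U \<in> borel_measurable M"
    using measurable_compose[OF Y fm] measurable_compose[OF Z um] by auto
  have U2: "integrable M (\<lambda>\<omega>. (?U \<omega>)\<^sup>2)"
    using g2 by (simp add: u_def restrict_subvector[OF BC])
  \<comment> \<open>On a probability space finite second moments give finite first moments, as the
    monotonicity hypothesis demands.\<close>
  note iV = square_integrable_imp_integrable[OF Vm f2]
    and iU = square_integrable_imp_integrable[OF Um U2]
  have iVU: "integrable M (\<lambda>\<omega>. ?V \<omega> * ?U \<omega>)"
  proof (rule Bochner_Integration.integrable_bound)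
    show "integrable M (\<lambda>\<omega>. (?V \<omega>)\<^sup>2 + (?U \<omega>)\<^sup>2)"
      using f2 U2 by simp
    have "\<bar>a * b\<bar> \<le> a\<^sup>2 + b\<^sup>2" for a b :: real
      using sum_squares_bound[of "\<bar>a\<bar>" "\<bar>b\<bar>"] abs_ge_zero[of "a * b"]
      unfolding abs_mult power2_abs by linarith
    then show "AE \<omega> in M. norm (?V \<omega> * ?U \<omega>) \<le> norm ((?V \<omega>)\<^sup>2 + (?U \<omega>)\<^sup>2)"
      by simp
  qed (use Vm Um in measurable)
  \<comment> \<open>The coordinate sum serves as the map \<open>\<phi>\<close> that exhibits
    \<open>S\<close> as a function of \<open>Y\<close>.\<close>
  have S: "?S = (\<lambda>\<omega>. \<Sum>i\<in>A. subvector X A \<omega> i)"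
    by (simp add: partial_sum_def subvector_def fun_eq_iff)
  have sum_meas: "(\<lambda>x. \<Sum>i\<in>A. x i) \<in> borel_measurable (borel_vec A)"
    by measurable
  have S_meas: "?S \<in> borel_measurable M" and S'_meas: "?S' \<in> borel_measurable M"
    unfolding partial_sum_def using assms(2) A C by (auto intro!: borel_measurable_sum)
  note prod = cond_indep_given_expectation_mult[OF Y Z sum_meas, OF S
      assms(4)[OF A, folded C_def] fm, OF iV um, OF iU iVU]
  \<comment> \<open>The joint mix property enters here: it makes the two partial sums reflections of
    each other, which reverses the direction of monotonicity.\<close>
  obtain c where c: "AE \<omega> in M. (\<Sum>i\<in>{1..n}. X i \<omega>) = c"
    using assms(3) by (auto simp: joint_mix_def)
  have "(\<Sum>i\<in>{1..n}. X i \<omega>) = ?S' \<omega> + ?S \<omega>" for \<omega>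
    unfolding partial_sum_def C_def by (rule sum.subset_diff[OF A]) simp
  then have refl: "AE \<omega> in M. ?S' \<omega> = c - ?S \<omega>"
    using c by (simp add: eq_diff_eq)
  obtain h where h: "mono h" "AE \<omega> in M. cond_exp_given M ?S ?V \<omega> = h (?S \<omega>)"
    using assms(5)[OF A f iV] by (auto simp: cond_exp_increasing_def)
  obtain k where k: "mono k" "AE \<omega> in M. cond_exp_given M ?S' ?U \<omega> = k (?S' \<omega>)"
    using assms(5)[OF C u iU] by (auto simp: cond_exp_increasing_def)
  \<comment> \<open>Reflection needs \<open>k\<close> to be Borel, which holds for every monotone
    real function.\<close>
  have k': "AE \<omega> in M. cond_exp_given M ?S ?U \<omega> = k (c - ?S \<omega>)"
    by (rule cond_exp_given_reflect[OF S_meas S'_meas refl iU borel_measurable_mono[OF k(1)] k(2)])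
  have anti: "antimono (\<lambda>s. k (c - s))"
    using k(1) by (auto simp: monotone_def)
  interpret F: sigma_finite_subalgebra M "vimage_algebra (space M) ?S borel"
    by (rule sigma_finite_subalgebra_vimage_algebra[OF S_meas])
  note iV' = F.real_cond_exp_int[OF iV, folded cond_exp_given_def]
    and iU' = F.real_cond_exp_int[OF iU, folded cond_exp_given_def]
  \<comment> \<open>The association inequality is applied to the conditional expectations;
    \<open>prod(2)\<close>, \<open>iV'(2)\<close> and \<open>iU'(2)\<close> return all three
    expectations to the original variables.\<close>
  have "expectation (\<lambda>\<omega>. ?V \<omega> * ?U \<omega>) \<le> expectation ?V * expectation ?U"
    using expectation_mult_le_opposite_monotone[OF h(1) anti h(2) k' iV'(1) iU'(1) prod(1)]
    unfolding prod(2) iV'(2) iU'(2) .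
  then have "covariance M ?V ?U \<le> 0"
    unfolding covariance_def using iV iU iVU by (simp add: algebra_simps prob_space)
  then show "covariance M ?V (\<lambda>\<omega>. g (subvector X B \<omega>)) \<le> 0"
    by (simp add: U_eq)
qed

end
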